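(* For a frame $L$, the following are equivalent: (1) $L$ is perfectly regular. (2) $L\cong \mathsf{DM}(\mathrm{Coz}\,L)$, where $\mathsf{DM}$ denotes the Dedekind-MacNeille completion. (3) $L\cong \mathsf{BL}(\mathrm{Coz}\,L)$, where $\mathsf{BL}$ denotes the Bruns-Lakser completion.
   Context: An element $a$ of a frame $L$ is a cozero element if $a=h(\mathbb{R}\setminus\{0\})$ for some frame homomorphism $h:\mathfrak{O}\mathbb{R}\to L$ ($\mathfrak{O}\mathbb{R}$ being the frame of opens of the real line); $\mathrm{Coz}\,L$ is the set of cozero elements of $L$ with the order induced from $L$ (it is closed under finite meets and countable joins in $L$). A subset $A\subseteq L$ join-generates (meet-generates) $L$ if every element of $L$ is a join (meet), computed in $L$, of elements of $A$. A frame $L$ is perfectly regular if $\mathrm{Coz}\,L$ both join-generates and meet-generates $L$. The Dedekind-MacNeille completion $\mathsf{DM}(A)$ of a poset $A$ is the (unique up to isomorphism) complete lattice containing $A$ (with its order) as a join-generating and meet-generating subset. The Bruns-Lakser completion $\mathsf{BL}(A)$ of a meet-semilattice $A$ is the injective hull of $A$ in the category of meet-semilattices; it is the frame of D-ideals of $A$ ordered by inclusion, where a D-ideal is a downset $I\subseteq A$ such that $\bigvee S\in I$ for every (possibly empty) $S\subseteq I$ for which $\bigvee S$ exists in $A$ and $a\wedge\bigvee S=\bigvee\{a\wedge s\mid s\in S\}$ for all $a\in A$. The symbol $\cong$ denotes isomorphism of complete lattices. *)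

theory Defs
  imports Complex_Main
begin

section \<open>Frames and cozero elements\<close>

text \<open>The library class \<open>complete_distrib_lattice\<close> is complete distributivity, which is
  stronger than the frame law.\<close>

class frame = complete_lattice +
  assumes inf_Sup_frame: "inf a (Sup S) = Sup (inf a ` S)"

text \<open>The frame of opens of a space is a set of sets and not a type, so a homomorphism out of
  it is a function on sets whose values at non-open sets are irrelevant. Preservation of the
  bottom element is the instance \<open>\<U> = {}\<close> of the last condition.\<close>

definition opens_frame_hom :: "('t::topological_space set \<Rightarrow> 'a::frame) \<Rightarrow> bool" where
  "opens_frame_hom h \<longleftrightarrow>
     h UNIV = top \<and>
     (\<forall>U V. open U \<longrightarrow> open V \<longrightarrow> h (U \<inter> V) = inf (h U) (h V)) \<and>
     (\<forall>\<U>. (\<forall>U\<in>\<U>. open U) \<longrightarrow> h (\<Union>\<U>) = Sup (h ` \<U>))"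

definition Coz :: "'a::frame set" where
  "Coz = {a. \<exists>h :: real set \<Rightarrow> 'a. opens_frame_hom h \<and> a = h (UNIV - {0})}"

definition join_generates :: "'a::complete_lattice set \<Rightarrow> bool" where
  "join_generates A \<longleftrightarrow> (\<forall>x. \<exists>S\<subseteq>A. x = Sup S)"

definition meet_generates :: "'a::complete_lattice set \<Rightarrow> bool" where
  "meet_generates A \<longleftrightarrow> (\<forall>x. \<exists>S\<subseteq>A. x = Inf S)"

definition perfectly_regular :: "'a::frame itself \<Rightarrow> bool" where
  "perfectly_regular _ \<longleftrightarrow> join_generates (Coz :: 'a set) \<and> meet_generates (Coz :: 'a set)"


section \<open>Posets given as subsets of an ordered type\<close>

text \<open>A set \<open>X\<close> of elements of an ordered type is regarded as a poset with the induced order.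
  Bounds, joins and meets below are those of \<open>X\<close> itself, which need not agree with those of
  the ambient type.\<close>

definition is_lub_in :: "'a::order set \<Rightarrow> 'a set \<Rightarrow> 'a \<Rightarrow> bool" where
  "is_lub_in X S u \<longleftrightarrow> u \<in> X \<and> (\<forall>s\<in>S. s \<le> u) \<and> (\<forall>v\<in>X. (\<forall>s\<in>S. s \<le> v) \<longrightarrow> u \<le> v)"

definition is_glb_in :: "'a::order set \<Rightarrow> 'a set \<Rightarrow> 'a \<Rightarrow> bool" where
  "is_glb_in X S l \<longleftrightarrow> l \<in> X \<and> (\<forall>s\<in>S. l \<le> s) \<and> (\<forall>v\<in>X. (\<forall>s\<in>S. v \<le> s) \<longrightarrow> v \<le> l)"

definition meet_in :: "'a::order set \<Rightarrow> 'a \<Rightarrow> 'a \<Rightarrow> 'a" where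
  "meet_in X a b = (THE m. is_glb_in X {a, b} m)"

definition complete_lattice_on :: "'a::order set \<Rightarrow> bool" where
  "complete_lattice_on X \<longleftrightarrow> (\<forall>S\<subseteq>X. (\<exists>u. is_lub_in X S u) \<and> (\<exists>l. is_glb_in X S l))"

text \<open>For complete lattices, the order isomorphisms are exactly the isomorphisms of complete
  lattices: they carry all joins to joins and all meets to meets.\<close>

definition order_isomorphic :: "'a::order set \<Rightarrow> 'b::order set \<Rightarrow> bool" (infix "\<cong>" 50) where
  "X \<cong> Y \<longleftrightarrow> (\<exists>f. bij_betw f X Y \<and> (\<forall>x\<in>X. \<forall>y\<in>X. x \<le> y \<longleftrightarrow> f x \<le> f y))"

lemma order_iso_is_lub_in:
  assumes f: "bij_betw f X Y" "\<forall>x\<in>X. \<forall>y\<in>X. x \<le> y \<longleftrightarrow> f x \<le> f y"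
    and S: "S \<subseteq> X" and u: "is_lub_in X S u"
  shows "is_lub_in Y (f ` S) (f u)"
proof -
  have Y: "Y = f ` X" using f(1) by (simp add: bij_betw_def)
  show ?thesis using u S f(2) unfolding is_lub_in_def Y by auto blast
qed

lemma order_iso_is_glb_in:
  assumes f: "bij_betw f X Y" "\<forall>x\<in>X. \<forall>y\<in>X. x \<le> y \<longleftrightarrow> f x \<le> f y"
    and S: "S \<subseteq> X" and l: "is_glb_in X S l"
  shows "is_glb_in Y (f ` S) (f l)"
proof -
  have Y: "Y = f ` X" using f(1) by (simp add: bij_betw_def)
  show ?thesis using l S f(2) unfolding is_glb_in_def Y by auto blast
qed

lemma is_glb_in_unique: "is_glb_in X S l \<Longrightarrow> is_glb_in X S l' \<Longrightarrow> l = l'"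
  by (auto simp: is_glb_in_def intro: order.antisym)

lemma meet_in_eq_inf:
  fixes a b :: "'a::semilattice_inf"
  assumes "inf a b \<in> X"
  shows "meet_in X a b = inf a b"
proof -
  have "is_glb_in X {a, b} (inf a b)"
    using assms by (auto simp: is_glb_in_def)
  then show ?thesis
    unfolding meet_in_def by (metis is_glb_in_unique the_equality)
qed


section \<open>The Dedekind-MacNeille completion\<close>

text \<open>\<open>dm_completion A X e\<close>: the poset \<open>X\<close> is a complete lattice containing \<open>A\<close>, via the order
  embedding \<open>e\<close>, as a join-generating and meet-generating subset.\<close>

definition dm_completion :: "'a::order set \<Rightarrow> 'b::order set \<Rightarrow> ('a \<Rightarrow> 'b) \<Rightarrow> bool" where
  "dm_completion A X e \<longleftrightarrow>
     complete_lattice_on X \<and>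
     e ` A \<subseteq> X \<and> (\<forall>a\<in>A. \<forall>b\<in>A. a \<le> b \<longleftrightarrow> e a \<le> e b) \<and>
     (\<forall>x\<in>X. \<exists>S\<subseteq>A. is_lub_in X (e ` S) x) \<and>
     (\<forall>x\<in>X. \<exists>S\<subseteq>A. is_glb_in X (e ` S) x)"

definition upper_in :: "'a::order set \<Rightarrow> 'a set \<Rightarrow> 'a set" where
  "upper_in A S = {u\<in>A. \<forall>s\<in>S. s \<le> u}"

definition lower_in :: "'a::order set \<Rightarrow> 'a set \<Rightarrow> 'a set" where
  "lower_in A S = {l\<in>A. \<forall>s\<in>S. l \<le> s}"

text \<open>\<open>DM A\<close> is the usual model by normal cuts, ordered by inclusion. By \<open>dm_completion_DM\<close> it
  is a completion of \<open>A\<close> in the above sense, and by \<open>dm_completion_unique\<close> any other one is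
  isomorphic to it.\<close>

definition DM :: "'a::order set \<Rightarrow> 'a set set" where
  "DM A = {I. I \<subseteq> A \<and> lower_in A (upper_in A I) = I}"

lemma lower_in_mem_DM: "S \<subseteq> A \<Longrightarrow> lower_in A S \<in> DM A"
  by (auto simp: DM_def lower_in_def upper_in_def)

lemma closure_least:
  assumes "J \<in> DM A" "S \<subseteq> J"
  shows "lower_in A (upper_in A S) \<subseteq> J"
proof -
  have "lower_in A (upper_in A S) \<subseteq> lower_in A (upper_in A J)"
    using assms(2) unfolding lower_in_def upper_in_def by blast
  then show ?thesis using assms(1) by (simp add: DM_def)
qed

lemma closure_mem_DM: "lower_in A (upper_in A S) \<in> DM A"
  by (rule lower_in_mem_DM) (auto simp: upper_in_def)

lemma subset_closure: "S \<subseteq> A \<Longrightarrow> S \<subseteq> lower_in A (upper_in A S)"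
  by (auto simp: lower_in_def upper_in_def)

lemma is_lub_in_DM:
  assumes "\<S> \<subseteq> DM A"
  shows "is_lub_in (DM A) \<S> (lower_in A (upper_in A (\<Union>\<S>)))"
proof -
  have "\<Union>\<S> \<subseteq> A" using assms by (auto simp: DM_def)
  then have "\<Union>\<S> \<subseteq> lower_in A (upper_in A (\<Union>\<S>))" by (rule subset_closure)
  then have "\<forall>I\<in>\<S>. I \<subseteq> lower_in A (upper_in A (\<Union>\<S>))" by blast
  moreover have "lower_in A (upper_in A (\<Union>\<S>)) \<subseteq> J" if "J \<in> DM A" "\<forall>I\<in>\<S>. I \<subseteq> J" for J
    using that by (intro closure_least) auto
  ultimately show ?thesis
    unfolding is_lub_in_def using closure_mem_DM by blast
qed

lemma is_glb_in_DM:
  assumes "\<S> \<subseteq> DM A"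
  shows "is_glb_in (DM A) \<S> (A \<inter> \<Inter>\<S>)"
proof -
  have "lower_in A (upper_in A (A \<inter> \<Inter>\<S>)) \<subseteq> A \<inter> \<Inter>\<S>"
  proof (intro Int_greatest Inter_greatest)
    show "lower_in A (upper_in A (A \<inter> \<Inter>\<S>)) \<subseteq> A" by (auto simp: lower_in_def)
  next
    fix J assume "J \<in> \<S>"
    then show "lower_in A (upper_in A (A \<inter> \<Inter>\<S>)) \<subseteq> J"
      using assms by (intro closure_least) auto
  qed
  then have "A \<inter> \<Inter>\<S> \<in> DM A"
    using subset_closure[of "A \<inter> \<Inter>\<S>" A] by (auto simp: DM_def)
  moreover have "J \<subseteq> A" if "J \<in> DM A" for J using that by (auto simp: DM_def)
  ultimately show ?thesis unfolding is_glb_in_def by blast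
qed

lemma dm_completion_DM: "dm_completion A (DM A) (\<lambda>a. {b\<in>A. b \<le> a})"
proof -
  define e where "e = (\<lambda>a. {b\<in>A. b \<le> a})"
  have mem: "b \<in> e a \<longleftrightarrow> b \<in> A \<and> b \<le> a" for a b by (simp add: e_def)
  have "e a = lower_in A {a}" for a by (simp add: e_def lower_in_def)
  then have e: "e ` A \<subseteq> DM A" by (simp add: image_subset_iff lower_in_mem_DM)
  have join: "\<exists>S\<subseteq>A. is_lub_in (DM A) (e ` S) I" if "I \<in> DM A" for I
  proof (intro exI conjI)
    have fix_I: "lower_in A (upper_in A I) = I" using that by (simp add: DM_def)
    show I: "I \<subseteq> A" using that by (simp add: DM_def)
    have down: "e a \<subseteq> I" if "a \<in> I" for a
    proof
      fix b assume "b \<in> e a"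
      then have "b \<in> A" "b \<le> a" by (simp_all add: mem)
      then have "b \<in> lower_in A (upper_in A I)"
        using \<open>a \<in> I\<close> by (auto simp: lower_in_def upper_in_def intro: order_trans[of b a])
      then show "b \<in> I" by (simp only: fix_I)
    qed
    have "a \<in> e a" if "a \<in> I" for a using that I by (auto simp: mem)
    then have "I \<subseteq> J" if "\<forall>s\<in>e ` I. s \<subseteq> J" for J
      using that by blast
    moreover have "\<forall>s\<in>e ` I. s \<subseteq> I" using down by blast
    ultimately show "is_lub_in (DM A) (e ` I) I"
      using that unfolding is_lub_in_def by blast
  qed
  have meet: "\<exists>S\<subseteq>A. is_glb_in (DM A) (e ` S) I" if "I \<in> DM A" for I
  proof (intro exI conjI)
    show U: "upper_in A I \<subseteq> A" by (auto simp: upper_in_def)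
    have "A \<inter> \<Inter>(e ` upper_in A I) = lower_in A (upper_in A I)"
      by (auto simp: lower_in_def mem)
    also have "\<dots> = I" using that by (simp add: DM_def)
    finally have eq: "A \<inter> \<Inter>(e ` upper_in A I) = I" .
    have "e ` upper_in A I \<subseteq> DM A" using e U by blast
    from is_glb_in_DM[OF this] show "is_glb_in (DM A) (e ` upper_in A I) I"
      unfolding eq .
  qed
  have "complete_lattice_on (DM A)"
    unfolding complete_lattice_on_def using is_lub_in_DM is_glb_in_DM by blast
  moreover have "a \<le> b \<longleftrightarrow> e a \<subseteq> e b" if "a \<in> A" "b \<in> A" for a b
  proof
    show "e a \<subseteq> e b" if "a \<le> b" using that by (auto simp: mem intro: order_trans[of _ a b])
    show "a \<le> b" if "e a \<subseteq> e b"
    proof -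
      have "a \<in> e a" using \<open>a \<in> A\<close> by (simp add: mem)
      then show ?thesis using that mem by blast
    qed
  qed
  ultimately have "dm_completion A (DM A) e"
    unfolding dm_completion_def using e join meet by (intro conjI ballI)
  then show ?thesis by (simp only: e_def)
qed

lemma dm_completion_unique:
  assumes "dm_completion A X e"
  shows "X \<cong> DM A"
proof -
  let ?f = "\<lambda>x. {a\<in>A. e a \<le> x}"
  have eX: "\<And>a. a \<in> A \<Longrightarrow> e a \<in> X"
    and emb: "\<And>a b. a \<in> A \<Longrightarrow> b \<in> A \<Longrightarrow> a \<le> b \<longleftrightarrow> e a \<le> e b"
    and join: "\<And>x. x \<in> X \<Longrightarrow> \<exists>S\<subseteq>A. is_lub_in X (e ` S) x"
    and meet: "\<And>x. x \<in> X \<Longrightarrow> \<exists>S\<subseteq>A. is_glb_in X (e ` S) x"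
    and lubs: "\<And>S. S \<subseteq> X \<Longrightarrow> \<exists>u. is_lub_in X S u"
    using assms by (auto simp: dm_completion_def complete_lattice_on_def)
  have ord: "x \<le> y \<longleftrightarrow> ?f x \<subseteq> ?f y" if x: "x \<in> X" and y: "y \<in> X" for x y
  proof
    assume "x \<le> y" then show "?f x \<subseteq> ?f y" by (auto intro: order_trans)
  next
    assume sub: "?f x \<subseteq> ?f y"
    obtain S where S: "S \<subseteq> A" "is_lub_in X (e ` S) x" using join[OF x] by blast
    then have "\<forall>s\<in>e ` S. s \<le> y" using sub by (auto simp: is_lub_in_def)
    then show "x \<le> y" using S(2) y by (auto simp: is_lub_in_def)
  qed
  have cut: "?f u = lower_in A (upper_in A I)"
    if I: "I \<subseteq> A" and u: "is_lub_in X (e ` I) u" for I u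
  proof -
    have ub: "u \<le> e b" if "b \<in> upper_in A I" for b
      using that u I eX emb by (auto simp: is_lub_in_def upper_in_def subset_iff)
    have "e a \<le> u" if a: "a \<in> lower_in A (upper_in A I)" for a
    proof -
      have aA: "a \<in> A" using a by (auto simp: lower_in_def)
      have uX: "u \<in> X" using u by (auto simp: is_lub_in_def)
      obtain S where S: "S \<subseteq> A" "is_glb_in X (e ` S) u" using meet[OF uX] by blast
      have "e a \<le> e b" if b: "b \<in> S" for b
      proof -
        have "u \<le> e b" using S(2) b by (auto simp: is_glb_in_def)
        moreover have "\<forall>i\<in>I. e i \<le> u" using u by (auto simp: is_lub_in_def)
        ultimately have "b \<in> upper_in A I"
          using b S(1) I emb by (auto simp: upper_in_def subset_iff intro: order_trans)
        then have "a \<le> b" using a by (auto simp: lower_in_def)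
        then show ?thesis using emb aA b S(1) by blast
      qed
      then show ?thesis using S(2) eX[OF aA] by (auto simp: is_glb_in_def)
    qed
    moreover have "a \<le> b" if "a \<in> A" "e a \<le> u" "b \<in> upper_in A I" for a b
      using ub[OF that(3)] that emb by (auto simp: upper_in_def intro: order_trans)
    ultimately show ?thesis by (auto simp: lower_in_def)
  qed
  have "?f ` X = DM A"
  proof
    show "?f ` X \<subseteq> DM A"
    proof
      fix J assume "J \<in> ?f ` X"
      then obtain x where x: "x \<in> X" "J = ?f x" by blast
      obtain S where "S \<subseteq> A" "is_lub_in X (e ` S) x" using join[OF x(1)] by blast
      then show "J \<in> DM A" using cut closure_mem_DM x(2) by metis
    qed
    show "DM A \<subseteq> ?f ` X"
    proof
      fix I assume I: "I \<in> DM A"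
      then have IA: "I \<subseteq> A" by (auto simp: DM_def)
      then have "e ` I \<subseteq> X" using eX by blast
      then obtain u where u: "is_lub_in X (e ` I) u" using lubs by blast
      then have "?f u = I" using cut[OF IA u] I by (simp add: DM_def)
      then show "I \<in> ?f ` X" using u unfolding is_lub_in_def by blast
    qed
  qed
  moreover have "inj_on ?f X"
    by (intro inj_onI order.antisym) (simp_all add: ord)
  ultimately have "bij_betw ?f X (DM A)" by (simp add: bij_betw_def)
  moreover have "\<forall>x\<in>X. \<forall>y\<in>X. x \<le> y \<longleftrightarrow> ?f x \<le> ?f y"
    using ord by simp
  ultimately show ?thesis
    unfolding order_isomorphic_def by (intro exI[of _ ?f] conjI)
qed


section \<open>The Bruns-Lakser completion\<close>

text \<open>\<open>A\<close> is meant to be a meet-semilattice. Both the joins and the meets are formed in \<open>A\<close>,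
  and \<open>S\<close> may be empty.\<close>

definition D_ideal :: "'a::order set \<Rightarrow> 'a set \<Rightarrow> bool" where
  "D_ideal A I \<longleftrightarrow>
     I \<subseteq> A \<and>
     (\<forall>x\<in>I. \<forall>y\<in>A. y \<le> x \<longrightarrow> y \<in> I) \<and>
     (\<forall>S u. S \<subseteq> I \<longrightarrow> is_lub_in A S u \<longrightarrow>
        (\<forall>a\<in>A. is_lub_in A (meet_in A a ` S) (meet_in A a u)) \<longrightarrow> u \<in> I)"

definition BL :: "'a::order set \<Rightarrow> 'a set set" where
  "BL A = {I. D_ideal A I}"

lemma BL_Inter:
  assumes "\<S> \<subseteq> BL A"
  shows "A \<inter> \<Inter>\<S> \<in> BL A"
proof -
  have D: "D_ideal A I" if "I \<in> \<S>" for I using assms that by (auto simp: BL_def)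
  have down: "y \<in> A \<inter> \<Inter>\<S>" if "x \<in> A \<inter> \<Inter>\<S>" "y \<in> A" "y \<le> x" for x y
    using that D unfolding D_ideal_def by blast
  have closed: "u \<in> A \<inter> \<Inter>\<S>"
    if S: "S \<subseteq> A \<inter> \<Inter>\<S>" and u: "is_lub_in A S u"
      and dist: "\<forall>a\<in>A. is_lub_in A (meet_in A a ` S) (meet_in A a u)" for S u
  proof (intro IntI InterI)
    show "u \<in> A" using u by (simp add: is_lub_in_def)
    fix I assume I: "I \<in> \<S>"
    then have "S \<subseteq> I" using S by blast
    then show "u \<in> I" using D[OF I] u dist unfolding D_ideal_def by simp
  qed
  have "D_ideal A (A \<inter> \<Inter>\<S>)"
    unfolding D_ideal_def
  proof (intro conjI ballI allI impI)
    show "A \<inter> \<Inter>\<S> \<subseteq> A" by blast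
  qed (fact down, fact closed)
  then show ?thesis by (simp add: BL_def)
qed

lemma complete_lattice_on_BL: "complete_lattice_on (BL A)"
  unfolding complete_lattice_on_def
proof (intro allI impI conjI)
  fix \<S> assume \<S>: "\<S> \<subseteq> BL A"
  have sub: "J \<subseteq> A" if "J \<in> BL A" for J using that by (auto simp: BL_def D_ideal_def)
  show "\<exists>l. is_glb_in (BL A) \<S> l"
  proof
    show "is_glb_in (BL A) \<S> (A \<inter> \<Inter>\<S>)"
      using BL_Inter[OF \<S>] sub unfolding is_glb_in_def by blast
  qed
  show "\<exists>u. is_lub_in (BL A) \<S> u"
  proof
    let ?\<T> = "{J\<in>BL A. \<forall>I\<in>\<S>. I \<subseteq> J}"
    have "A \<inter> \<Inter>?\<T> \<in> BL A" by (rule BL_Inter) blast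
    moreover have "\<forall>I\<in>\<S>. I \<subseteq> A \<inter> \<Inter>?\<T>" using \<S> sub by blast
    ultimately show "is_lub_in (BL A) \<S> (A \<inter> \<Inter>?\<T>)"
      unfolding is_lub_in_def by blast
  qed
qed

end

theory Submission
  imports Defs "HOL-Analysis.Elementary_Metric_Spaces"
begin

text \<open>If \<open>h\<close> is a homomorphism from the opens of the real line to \<open>L\<close>, then \<open>h U\<close> is a cozero
  element for every open \<open>U\<close>. Hence an order embedding \<open>p\<close> of \<open>Coz L\<close> into \<open>L\<close> that preserves the
  joins and meets existing in \<open>Coz L\<close> turns \<open>h\<close> into another homomorphism, and so maps cozero
  elements to cozero elements. Any isomorphism \<open>DM (Coz L) \<cong> L\<close> restricts to such a \<open>p\<close>
  with a join- and meet-generating image, although it need not restrict to the identity on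
  \<open>Coz L\<close>. For the Bruns-Lakser completion, the complete regularity of \<open>Coz L\<close> forces every
  D-ideal to be a normal ideal, so that \<open>BL (Coz L) = DM (Coz L)\<close> for every frame \<open>L\<close>.\<close>

section \<open>Frame homomorphisms on open sets\<close>

lemma inf_sup_frame: "inf a (sup b c) = sup (inf a b) (inf a (c::'a::frame))"
  using inf_Sup_frame[of a "{b, c}"] by simp

lemma Sup_inf_frame: "inf (Sup S) a = Sup ((\<lambda>s. inf s a) ` S)" for a :: "'a::frame"
  using inf_Sup_frame[of a S] by (simp add: inf.commute)

lemma opens_frame_homD:
  assumes "opens_frame_hom h"
  shows opens_frame_hom_UNIV: "h UNIV = top"
    and opens_frame_hom_Int: "open U \<Longrightarrow> open V \<Longrightarrow> h (U \<inter> V) = inf (h U) (h V)"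
    and opens_frame_hom_Union: "(\<And>U. U \<in> \<U> \<Longrightarrow> open U) \<Longrightarrow> h (\<Union>\<U>) = Sup (h ` \<U>)"
  using assms by (simp_all add: opens_frame_hom_def)

lemma opens_frame_hom_empty: "opens_frame_hom h \<Longrightarrow> h {} = bot"
  using opens_frame_hom_Union[of h "{}"] by simp

lemma opens_frame_hom_Un:
  assumes "opens_frame_hom h" "open U" "open V"
  shows "h (U \<union> V) = sup (h U) (h V)"
  using opens_frame_hom_Union[of h "{U, V}"] assms by auto

lemma opens_frame_hom_mono:
  assumes "opens_frame_hom h" "open U" "open V" "U \<subseteq> V"
  shows "h U \<le> h V"
  using opens_frame_hom_Int[OF assms(1-3)] assms(4) by (simp add: Int_absorb2 inf.absorb_iff1)

lemma opens_frame_hom_vimage: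
  fixes \<phi> :: "'s::topological_space \<Rightarrow> 't::topological_space"
  assumes h: "opens_frame_hom h" and \<phi>: "continuous_on UNIV \<phi>"
  shows "opens_frame_hom (\<lambda>U. h (\<phi> -` U))"
proof -
  have op: "open (\<phi> -` U)" if "open U" for U
    using open_vimage[OF that \<phi>] .
  have "h (\<phi> -` \<Union>\<U>) = Sup ((\<lambda>U. h (\<phi> -` U)) ` \<U>)" if "\<forall>U\<in>\<U>. open U" for \<U>
    using opens_frame_hom_Union[OF h, of "(\<lambda>U. \<phi> -` U) ` \<U>"] that op
    by (auto simp: image_image vimage_Union)
  then show ?thesis
    using opens_frame_homD[OF h] op by (simp add: opens_frame_hom_def vimage_Int)
qed

lemma Coz_vimage:
  assumes "opens_frame_hom h" "continuous_on UNIV \<phi>"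
  shows "h (\<phi> -` (UNIV - {0::real})) \<in> Coz"
  using opens_frame_hom_vimage[OF assms] by (auto simp: Coz_def)

text \<open>In a metric space an open set is the nonvanishing set of the distance to its complement.
  Precomposing \<open>h\<close> with preimages along this continuous function gives a homomorphism
  on the opens of the real line.\<close>

lemma hom_open_mem_Coz:
  fixes h :: "'t::metric_space set \<Rightarrow> 'a::frame"
  assumes h: "opens_frame_hom h" and U: "open U"
  shows "h U \<in> Coz"
proof (cases "U = UNIV")
  \<comment> \<open>By convention \<open>infdist\<close> to the empty set is 0, so the distance
    function would have empty nonvanishing set here; the constant 1 replaces it.\<close>
  case True
  then have "U = (\<lambda>_. 1::real) -` (UNIV - {0})" by auto
  then show ?thesis using Coz_vimage[OF h, of "\<lambda>_. 1"] by simp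
next
  case False
  then have "U = (\<lambda>x. infdist x (- U)) -` (UNIV - {0})"
    using U in_closed_iff_infdist_zero[of "- U"] by auto
  then show ?thesis
    using Coz_vimage[OF h, of "\<lambda>x. infdist x (- U)"] continuous_on_infdist[OF continuous_on_id]
    by metis
qed


section \<open>The product homomorphism\<close>

text \<open>The only candidate for a homomorphism on the opens of the product space that extends
  \<open>h\<close> and \<open>k\<close> along the projections: an open set is a union of open boxes,
  and a box must go to the meet of the values of its sides. Using all boxes inside \<open>W\<close>
  avoids choosing a decomposition.\<close>

definition box_hom ::
  "('s::topological_space set \<Rightarrow> 'a::frame) \<Rightarrow> ('t::topological_space set \<Rightarrow> 'a)
    \<Rightarrow> ('s \<times> 't) set \<Rightarrow> 'a" where
  "box_hom h k W = Sup {inf (h U) (k V) | U V. open U \<and> open V \<and> U \<times> V \<subseteq> W}"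

lemma box_le_box_hom:
  "open U \<Longrightarrow> open V \<Longrightarrow> U \<times> V \<subseteq> W \<Longrightarrow> inf (h U) (k V) \<le> box_hom h k W"
  unfolding box_hom_def by (rule Sup_upper) blast

lemma box_hom_least:
  "(\<And>U V. open U \<Longrightarrow> open V \<Longrightarrow> U \<times> V \<subseteq> W \<Longrightarrow> inf (h U) (k V) \<le> s) \<Longrightarrow> box_hom h k W \<le> s"
  unfolding box_hom_def by (rule Sup_least) blast

lemma box_hom_mono: "W \<subseteq> W' \<Longrightarrow> box_hom h k W \<le> box_hom h k W'"
  by (rule box_hom_least) (blast intro: box_le_box_hom)

text \<open>Local compactness of one factor makes the localic product spatial: over a compact part
  of \<open>V\<close>, finitely many boxes of the cover already cover a tube.\<close>

lemma box_le_Sup_box_hom: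
  fixes k :: "'t::heine_borel set \<Rightarrow> 'a::frame"
  assumes h: "opens_frame_hom h" and k: "opens_frame_hom k"
    and U: "open U" and V: "open V" and \<W>: "\<And>W. W \<in> \<W> \<Longrightarrow> open W"
    and cov: "U \<times> V \<subseteq> \<Union>\<W>"
  shows "inf (h U) (k V) \<le> Sup (box_hom h k ` \<W>)" (is "_ \<le> ?s")
proof -
  have tube: "\<exists>N. open N \<and> x \<in> N \<and> N \<subseteq> U \<and> inf (h N) (k V') \<le> ?s"
    if x: "x \<in> U" and V': "open V'" "V' \<subseteq> M" and M: "compact M" "M \<subseteq> V" for x V' M
  proof -
    have "\<exists>A B. open A \<and> open B \<and> x \<in> A \<and> y \<in> B \<and> (\<exists>W\<in>\<W>. A \<times> B \<subseteq> W)" if "y \<in> M" for y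
    proof -
      obtain W where W: "W \<in> \<W>" "(x, y) \<in> W" using cov x \<open>y \<in> M\<close> M by blast
      obtain A B where "open A" "open B" "(x, y) \<in> A \<times> B" "A \<times> B \<subseteq> W"
        using open_prod_elim[OF \<W>[OF W(1)] W(2)] .
      then show ?thesis using W(1) by blast
    qed
    then obtain A B where AB: "\<And>y. y \<in> M \<Longrightarrow> open (A y)" "\<And>y. y \<in> M \<Longrightarrow> open (B y)"
        "\<And>y. y \<in> M \<Longrightarrow> x \<in> A y" "\<And>y. y \<in> M \<Longrightarrow> y \<in> B y"
        "\<And>y. y \<in> M \<Longrightarrow> \<exists>W\<in>\<W>. A y \<times> B y \<subseteq> W"
      by metis
    have "M \<subseteq> (\<Union>y\<in>M. B y)" using AB(4) by blast
    then obtain C where C: "C \<subseteq> M" "finite C" "M \<subseteq> (\<Union>y\<in>C. B y)"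
      using compactE_image[OF M(1), of M B] AB(2) by blast
    \<comment> \<open>Finiteness of \<open>C\<close> makes \<open>N\<close> open; the factor
      \<open>U\<close> keeps \<open>N\<close> inside \<open>U\<close> even when \<open>C\<close> is
      empty.\<close>
    define N where "N = U \<inter> (\<Inter>y\<in>C. A y)"
    have N: "open N" unfolding N_def using U C AB(1) by (intro open_Int open_INT) auto
    have "open (\<Union>(B ` C))" using C(1) AB(2) by (intro open_UN) auto
    then have "k V' \<le> k (\<Union>(B ` C))"
      using k V' C(3) by (intro opens_frame_hom_mono) auto
    also have "\<dots> = Sup (k ` B ` C)"
      using C AB(2) by (intro opens_frame_hom_Union[OF k]) auto
    finally have "inf (h N) (k V') \<le> inf (h N) (Sup (k ` B ` C))"
      by (rule inf_mono[OF order_refl])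
    also have "\<dots> = Sup (inf (h N) ` k ` B ` C)" by (rule inf_Sup_frame)
    also have "\<dots> \<le> ?s"
    proof (rule Sup_least, clarify)
      fix y assume y: "y \<in> C"
      then obtain W where W: "W \<in> \<W>" "A y \<times> B y \<subseteq> W" using AB(5) C(1) by blast
      have "h N \<le> h (A y)"
        using h N AB(1) C(1) y by (intro opens_frame_hom_mono) (auto simp: N_def)
      then have "inf (h N) (k (B y)) \<le> inf (h (A y)) (k (B y))"
        by (rule inf_mono) simp
      also have "\<dots> \<le> box_hom h k W"
        using AB C(1) y W(2) by (intro box_le_box_hom) auto
      also have "\<dots> \<le> ?s" using W(1) by (intro Sup_upper) simp
      finally show "inf (h N) (k (B y)) \<le> ?s" .
    qed
    finally have "inf (h N) (k V') \<le> ?s" .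
    moreover have "x \<in> N" using x AB(3) C(1) by (auto simp: N_def)
    ultimately show ?thesis using N by (auto simp: N_def)
  qed
  have compactly_below: "inf (h U) (k V') \<le> ?s"
    if "open V'" "V' \<subseteq> M" "compact M" "M \<subseteq> V" for V' M
  proof -
    \<comment> \<open>The tubes exhaust \<open>U\<close>, so the frame law passes the bound from
      their bases to all of \<open>U\<close>.\<close>
    let ?\<U> = "{N. open N \<and> N \<subseteq> U \<and> inf (h N) (k V') \<le> ?s}"
    have "U = \<Union>?\<U>" using tube[OF _ that] by auto
    then have "h U = Sup (h ` ?\<U>)" using opens_frame_hom_Union[OF h, of ?\<U>] by simp
    then show ?thesis by (auto simp: Sup_inf_frame intro!: Sup_least)
  qed
  \<comment> \<open>Local compactness: closed balls are compact by Heine-Borel, so \<open>V\<close>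
    is the union of the open sets that sit inside a compact part of \<open>V\<close>.\<close>
  let ?\<V> = "{V'. open V' \<and> (\<exists>M. V' \<subseteq> M \<and> compact M \<and> M \<subseteq> V)}"
  have "y \<in> \<Union>?\<V>" if y: "y \<in> V" for y
  proof -
    obtain e where e: "e > 0" "cball y e \<subseteq> V" using V y open_contains_cball by blast
    then have "ball y e \<in> ?\<V>"
      by (auto intro!: exI[of _ "cball y e"] simp: compact_eq_bounded_closed)
    then show ?thesis using e(1) centre_in_ball by blast
  qed
  then have "V = \<Union>?\<V>" by auto
  then have "k V = Sup (k ` ?\<V>)" using opens_frame_hom_Union[OF k, of ?\<V>] by simp
  then show ?thesis using compactly_below by (auto simp: inf_Sup_frame intro!: Sup_least)
qed

text \<open>Boxes intersect in boxes, so binary meets follow from the frame law. For unions one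
  inequality is monotonicity and the other is the tube argument.\<close>

lemma opens_frame_hom_box_hom:
  fixes k :: "'t::heine_borel set \<Rightarrow> 'a::frame"
  assumes h: "opens_frame_hom h" and k: "opens_frame_hom k"
  shows "opens_frame_hom (box_hom h k)"
  unfolding opens_frame_hom_def
proof (intro conjI allI impI)
  show "box_hom h k UNIV = top"
    using box_le_box_hom[of UNIV UNIV UNIV h k] opens_frame_hom_UNIV[OF h] opens_frame_hom_UNIV[OF k]
    by (simp add: top_unique)
next
  fix W W' :: "('b \<times> 't) set"
  assume "open W" "open W'"
  have "inf (inf (h U) (k V)) (inf (h U') (k V')) \<le> box_hom h k (W \<inter> W')"
    if "open U" "open V" "U \<times> V \<subseteq> W" "open U'" "open V'" "U' \<times> V' \<subseteq> W'" for U V U' V'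
  proof -
    have "inf (inf (h U) (k V)) (inf (h U') (k V')) = inf (h (U \<inter> U')) (k (V \<inter> V'))"
      using that opens_frame_hom_Int[OF h] opens_frame_hom_Int[OF k] by (simp add: ac_simps)
    also have "\<dots> \<le> box_hom h k (W \<inter> W')"
      using that by (intro box_le_box_hom) auto
    finally show ?thesis .
  qed
  then have "inf (box_hom h k W) (box_hom h k W') \<le> box_hom h k (W \<inter> W')"
    unfolding box_hom_def[of h k W] box_hom_def[of h k W'] Sup_inf_frame inf_Sup_frame
    by (auto intro!: Sup_least)
  then show "box_hom h k (W \<inter> W') = inf (box_hom h k W) (box_hom h k W')"
    by (intro order.antisym le_infI) (auto intro: box_hom_mono)
next
  fix \<W> :: "('b \<times> 't) set set"
  assume \<W>: "\<forall>W\<in>\<W>. open W"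
  show "box_hom h k (\<Union>\<W>) = Sup (box_hom h k ` \<W>)"
  proof (rule order.antisym)
    show "box_hom h k (\<Union>\<W>) \<le> Sup (box_hom h k ` \<W>)"
      using \<W> by (intro box_hom_least box_le_Sup_box_hom[OF h k]) auto
    show "Sup (box_hom h k ` \<W>) \<le> box_hom h k (\<Union>\<W>)"
      by (auto intro!: Sup_least box_hom_mono)
  qed
qed

lemma box_hom_Times:
  assumes h: "opens_frame_hom h" and k: "opens_frame_hom k" and UV: "open U" "open V"
  shows "box_hom h k (U \<times> V) = inf (h U) (k V)"
proof (rule order.antisym)
  show "box_hom h k (U \<times> V) \<le> inf (h U) (k V)"
  proof (rule box_hom_least)
    fix U' V' assume o: "open U'" "open V'" and sub: "U' \<times> V' \<subseteq> U \<times> V"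
    show "inf (h U') (k V') \<le> inf (h U) (k V)"
    \<comment> \<open>An empty box may have a side outside \<open>U\<close> or \<open>V\<close>, but
      then its value is \<open>bot\<close>.\<close>
    proof (cases "U' = {} \<or> V' = {}")
      case True
      then show ?thesis using opens_frame_hom_empty[OF h] opens_frame_hom_empty[OF k] by auto
    next
      case False
      then have "U' \<subseteq> U" "V' \<subseteq> V" using sub by auto
      then show ?thesis using o UV h k by (intro inf_mono opens_frame_hom_mono)
    qed
  qed
qed (simp add: UV box_le_box_hom)


section \<open>The lattice of cozero elements\<close>

lemma CozE:
  fixes a :: "'a::frame"
  assumes "a \<in> Coz"
  obtains h :: "real set \<Rightarrow> 'a" where "opens_frame_hom h" "h (UNIV - {0}) = a"
  using assms by (auto simp: Coz_def)

lemma open_Diff_zero: "open (UNIV - {0::real})"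
  by (simp add: open_Diff)

text \<open>One homomorphism on the opens of the plane represents both elements at once. Their meet
  is its value at the complement of the two axes, their join its value at the complement of the
  origin; both sets are open in a metric space.\<close>

lemma Coz_inf_sup:
  fixes a b :: "'a::frame"
  assumes "a \<in> Coz" "b \<in> Coz"
  shows "inf a b \<in> Coz" "sup a b \<in> Coz"
proof -
  obtain h k :: "real set \<Rightarrow> 'a" where h: "opens_frame_hom h" "h (UNIV - {0}) = a"
    and k: "opens_frame_hom k" "k (UNIV - {0}) = b"
    using assms by (metis CozE)
  let ?g = "box_hom h k"
  note o = open_Diff_zero
  have g: "opens_frame_hom ?g" by (rule opens_frame_hom_box_hom[OF h(1) k(1)])
  have "?g ((UNIV - {0}) \<times> (UNIV - {0})) = inf a b"
    using box_hom_Times[OF h(1) k(1) o o] h k by simp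
  then show "inf a b \<in> Coz"
    using hom_open_mem_Coz[OF g open_Times[OF o o]] by simp
  have "?g ((UNIV - {0}) \<times> UNIV \<union> UNIV \<times> (UNIV - {0})) = sup a b"
    using opens_frame_hom_Un[OF g open_Times[OF o open_UNIV] open_Times[OF open_UNIV o]]
      box_hom_Times[OF h(1) k(1) o open_UNIV] box_hom_Times[OF h(1) k(1) open_UNIV o]
      h k opens_frame_hom_UNIV[OF h(1)] opens_frame_hom_UNIV[OF k(1)] by simp
  then show "sup a b \<in> Coz"
    using hom_open_mem_Coz[OF g, of "(UNIV - {0}) \<times> UNIV \<union> UNIV \<times> (UNIV - {0})"]
      open_Un[OF open_Times[OF o open_UNIV] open_Times[OF open_UNIV o]] by simp
qed

text \<open>Complete regularity in the form of a test for \<open>c \<le> u\<close>: \<open>c\<close>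
  is the join of the values of \<open>h\<close> at the sets where the absolute value exceeds some
  \<open>e > 0\<close>, and each of these is separated from the complement of \<open>c\<close> by
  the cozero element \<open>h {x. \<bar>x\<bar> < e}\<close>.\<close>

lemma Coz_regular:
  fixes c u :: "'a::frame"
  assumes c: "c \<in> Coz"
    and le: "\<And>c' d. d \<in> Coz \<Longrightarrow> inf c' d = bot \<Longrightarrow> sup d c = top \<Longrightarrow> c' \<le> c \<Longrightarrow> c' \<le> u"
  shows "c \<le> u"
proof -
  obtain h :: "real set \<Rightarrow> 'a" where h: "opens_frame_hom h" "h (UNIV - {0}) = c"
    using c by (rule CozE)
  have opens: "open {x::real. \<bar>x\<bar> > e}" "open {x::real. \<bar>x\<bar> < e}" for e
    by (auto intro!: open_Collect_less continuous_intros)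
  have "h {x. \<bar>x\<bar> > e} \<le> u" if e: "e > 0" for e
  proof (rule le)
    show "h {x. \<bar>x\<bar> < e} \<in> Coz" by (rule hom_open_mem_Coz[OF h(1) opens(2)])
    have "{x. \<bar>x\<bar> > e} \<inter> {x. \<bar>x\<bar> < e} = {}" by auto
    then show "inf (h {x. \<bar>x\<bar> > e}) (h {x. \<bar>x\<bar> < e}) = bot"
      using opens_frame_hom_Int[OF h(1) opens(1,2)] opens_frame_hom_empty[OF h(1)] by metis
    have "{x. \<bar>x\<bar> < e} \<union> (UNIV - {0}) = UNIV" using e by auto
    then show "sup (h {x. \<bar>x\<bar> < e}) c = top"
      using opens_frame_hom_Un[OF h(1) opens(2) open_Diff_zero] opens_frame_hom_UNIV[OF h(1)] h(2)
      by metis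
    have "h {x. \<bar>x\<bar> > e} \<le> h (UNIV - {0})"
      using e by (intro opens_frame_hom_mono[OF h(1) opens(1) open_Diff_zero]) auto
    then show "h {x. \<bar>x\<bar> > e} \<le> c" by (simp add: h(2))
  qed
  moreover have "UNIV - {0::real} = \<Union>((\<lambda>e. {x. \<bar>x\<bar> > e}) ` {0<..})"
    using dense[of 0 "\<bar>_ :: real\<bar>"] by (force simp del: zero_less_abs_iff)
  then have "c = Sup (h ` (\<lambda>e. {x. \<bar>x\<bar> > e}) ` {0<..})"
    using opens_frame_hom_Union[OF h(1), of "(\<lambda>e. {x. \<bar>x\<bar> > e}) ` {0<..}"] opens(1) h(2) by auto
  ultimately show ?thesis by (auto intro!: Sup_least)
qed

section \<open>D-ideals and normal cuts\<close>

lemma DM_subset_BL: "DM A \<subseteq> BL A"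
proof
  fix I assume "I \<in> DM A"
  then have I: "I \<subseteq> A" "lower_in A (upper_in A I) = I" by (auto simp: DM_def)
  have "y \<in> I" if "x \<in> I" "y \<in> A" "y \<le> x" for x y
  proof -
    have "y \<in> lower_in A (upper_in A I)"
      using that by (auto simp: lower_in_def upper_in_def intro: order_trans)
    then show ?thesis by (simp only: I(2))
  qed
  \<comment> \<open>A join in \<open>A\<close> of elements of \<open>I\<close> lies below every
    upper bound of \<open>I\<close>, hence in the cut.\<close>
  moreover have "u \<in> I" if "S \<subseteq> I" "is_lub_in A S u" for S u
  proof -
    have "u \<in> lower_in A (upper_in A I)"
      using that unfolding lower_in_def upper_in_def is_lub_in_def by blast
    then show ?thesis by (simp only: I(2))
  qed
  ultimately show "I \<in> BL A" using I(1) by (simp add: BL_def D_ideal_def)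
qed

text \<open>An element \<open>x\<close> of the normal closure of a D-ideal \<open>I\<close> is the
  join in \<open>Coz\<close> of the elements \<open>inf i x\<close>, which belong to
  \<open>I\<close>, and meets with cozero elements distribute over this join; so \<open>x\<close> is
  in \<open>I\<close>. Both facts come from the single inequality \<open>le\<close>.\<close>

lemma BL_Coz: "BL Coz = DM (Coz :: 'a::frame set)"
proof
  show "BL Coz \<subseteq> DM (Coz :: 'a set)"
  proof
    fix I :: "'a set" assume "I \<in> BL Coz"
    then have I: "I \<subseteq> Coz" "\<And>x y. x \<in> I \<Longrightarrow> y \<in> Coz \<Longrightarrow> y \<le> x \<Longrightarrow> y \<in> I"
      and join: "\<And>S u. S \<subseteq> I \<Longrightarrow> is_lub_in Coz S u \<Longrightarrow>
        (\<forall>a\<in>Coz. is_lub_in Coz (meet_in Coz a ` S) (meet_in Coz a u)) \<Longrightarrow> u \<in> I"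
      by (auto simp: BL_def D_ideal_def)
    have "x \<in> I" if x: "x \<in> lower_in Coz (upper_in Coz I)" for x
    proof -
      have xC: "x \<in> Coz" using x by (simp add: lower_in_def)
      let ?S = "(\<lambda>i. inf i x) ` I"
      have S: "?S \<subseteq> I" using I xC Coz_inf_sup(1) by fastforce
      text \<open>If \<open>d\<close> complements a part \<open>c'\<close> of \<open>inf a x\<close>, then \<open>sup d u\<close> bounds \<open>I\<close>,
        hence \<open>x\<close>, hence \<open>c'\<close>.\<close>
      have le: "inf a x \<le> u"
        if a: "a \<in> Coz" and u: "u \<in> Coz" and ub: "\<And>i. i \<in> I \<Longrightarrow> inf a (inf i x) \<le> u" for a u
      proof (rule Coz_regular)
        show "inf a x \<in> Coz" using a xC by (rule Coz_inf_sup)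
        fix c' d :: 'a
        assume d: "d \<in> Coz" "inf c' d = bot" "sup d (inf a x) = top" and c': "c' \<le> inf a x"
        have "i \<le> sup d u" if i: "i \<in> I" for i
        proof -
          have "i = inf i (sup d (inf a x))" by (simp add: d(3))
          also have "\<dots> = sup (inf i d) (inf a (inf i x))" by (simp add: inf_sup_frame ac_simps)
          also have "\<dots> \<le> sup d u" using ub[OF i] by (intro sup_mono) auto
          finally show ?thesis .
        qed
        then have "sup d u \<in> upper_in Coz I" using d(1) u Coz_inf_sup(2) by (simp add: upper_in_def)
        then have "x \<le> sup d u" using x by (simp add: lower_in_def)
        then have "c' = inf c' (sup d u)" using c' by (metis inf.absorb1 le_inf_iff order_trans)
        also have "\<dots> = inf c' u" by (simp add: inf_sup_frame d(2))
        finally show "c' \<le> u" by (simp add: inf.absorb_iff1)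
      qed
      \<comment> \<open>This is \<open>le\<close> for \<open>a = x\<close>, where
        \<open>inf x x\<close> is \<open>x\<close>.\<close>
      have xS: "is_lub_in Coz ?S x"
        using le[OF xC] xC by (auto simp: is_lub_in_def inf.left_commute)
      have "is_lub_in Coz (meet_in Coz a ` ?S) (meet_in Coz a x)" if a: "a \<in> Coz" for a
      proof -
        \<comment> \<open>D-ideals refer to meets of the poset \<open>Coz\<close>; closure under
          binary meets identifies them with those of the frame.\<close>
        have "meet_in Coz a s = inf a s" if "s \<in> ?S \<or> s = x" for s
          using that S I(1) xC a Coz_inf_sup(1) meet_in_eq_inf by blast
        then have "meet_in Coz a x = inf a x"
            "meet_in Coz a ` ?S = (\<lambda>i. inf a (inf i x)) ` I"
          by (auto simp: image_image)
        then show ?thesis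
          using le[OF a] a xC Coz_inf_sup(1) by (auto simp: is_lub_in_def intro: le_infI2)
      qed
      then show ?thesis using join[OF S xS] by blast
    qed
    then show "I \<in> DM Coz" using I(1) subset_closure[OF I(1)] by (auto simp: DM_def)
  qed
qed (rule DM_subset_BL)


section \<open>Completions carried by a complete lattice\<close>

lemma order_isomorphic_sym:
  assumes "X \<cong> Y"
  shows "Y \<cong> X"
proof -
  obtain f where f: "bij_betw f X Y" "\<forall>x\<in>X. \<forall>y\<in>X. x \<le> y \<longleftrightarrow> f x \<le> f y"
    using assms by (auto simp: order_isomorphic_def)
  let ?g = "inv_into X f"
  have "bij_betw ?g Y X" using f(1) by (rule bij_betw_inv_into)
  moreover from this have "x \<le> y \<longleftrightarrow> ?g x \<le> ?g y" if "x \<in> Y" "y \<in> Y" for x y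
    using that f bij_betw_inv_into_right[OF f(1)] bij_betwE by metis
  ultimately show ?thesis unfolding order_isomorphic_def by blast
qed

lemma dm_completion_order_isomorphic:
  assumes "dm_completion A X e" "X \<cong> Y"
  shows "\<exists>p. dm_completion A Y p"
proof -
  obtain f where f: "bij_betw f X Y" "\<forall>x\<in>X. \<forall>y\<in>X. x \<le> y \<longleftrightarrow> f x \<le> f y"
    using assms(2) by (auto simp: order_isomorphic_def)
  have Y: "Y = f ` X" using f(1) by (simp add: bij_betw_def)
  note lub = order_iso_is_lub_in[OF f] and glb = order_iso_is_glb_in[OF f]
  have eX: "e ` A \<subseteq> X" and cl: "complete_lattice_on X"
    and gen: "\<And>x. x \<in> X \<Longrightarrow> \<exists>S\<subseteq>A. is_lub_in X (e ` S) x"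
      "\<And>x. x \<in> X \<Longrightarrow> \<exists>S\<subseteq>A. is_glb_in X (e ` S) x"
    using assms(1) by (auto simp: dm_completion_def)
  have "dm_completion A Y (f \<circ> e)"
    unfolding dm_completion_def
  proof (intro conjI ballI)
    show "complete_lattice_on Y"
      unfolding complete_lattice_on_def
    proof (intro allI impI)
      fix T assume "T \<subseteq> Y"
      then obtain S where "S \<subseteq> X" "T = f ` S" unfolding Y by (auto simp: subset_image_iff)
      then show "(\<exists>u. is_lub_in Y T u) \<and> (\<exists>l. is_glb_in Y T l)"
        using cl lub glb unfolding complete_lattice_on_def by blast
    qed
    show "(f \<circ> e) ` A \<subseteq> Y" using eX Y by auto
    fix a b assume "a \<in> A" "b \<in> A"
    then show "a \<le> b \<longleftrightarrow> (f \<circ> e) a \<le> (f \<circ> e) b"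
      using assms(1) f(2) eX by (auto simp: dm_completion_def)
  next
    fix y assume "y \<in> Y"
    then obtain x where x: "x \<in> X" "y = f x" unfolding Y by blast
    obtain S where S: "S \<subseteq> A" "is_lub_in X (e ` S) x" using gen(1)[OF x(1)] by blast
    then have "is_lub_in Y (f ` e ` S) (f x)" using eX by (intro lub) auto
    then show "\<exists>S\<subseteq>A. is_lub_in Y ((f \<circ> e) ` S) y" using S(1) x(2) by (auto simp: image_comp)
  next
    fix y assume "y \<in> Y"
    then obtain x where x: "x \<in> X" "y = f x" unfolding Y by blast
    obtain S where S: "S \<subseteq> A" "is_glb_in X (e ` S) x" using gen(2)[OF x(1)] by blast
    then have "is_glb_in Y (f ` e ` S) (f x)" using eX by (intro glb) auto
    then show "\<exists>S\<subseteq>A. is_glb_in Y ((f \<circ> e) ` S) y" using S(1) x(2) by (auto simp: image_comp)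
  qed
  then show ?thesis by blast
qed

lemma is_lub_in_UNIV: "is_lub_in UNIV S u \<longleftrightarrow> u = Sup S" for u :: "'a::complete_lattice"
  unfolding is_lub_in_def by (auto intro: order.antisym Sup_upper Sup_least)

lemma is_glb_in_UNIV: "is_glb_in UNIV S l \<longleftrightarrow> l = Inf S" for l :: "'a::complete_lattice"
  unfolding is_glb_in_def by (auto intro: order.antisym Inf_lower Inf_greatest)

lemma dm_completion_UNIV:
  "dm_completion A (UNIV :: 'b::complete_lattice set) p \<longleftrightarrow>
    (\<forall>a\<in>A. \<forall>b\<in>A. a \<le> b \<longleftrightarrow> p a \<le> p b) \<and>
    (\<forall>x. \<exists>S\<subseteq>A. x = Sup (p ` S)) \<and> (\<forall>x. \<exists>S\<subseteq>A. x = Inf (p ` S))"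
  by (auto simp: dm_completion_def complete_lattice_on_def is_lub_in_UNIV is_glb_in_UNIV)

lemma dm_completion_preserves_lub:
  fixes p :: "'a::order \<Rightarrow> 'b::complete_lattice"
  assumes p: "dm_completion A UNIV p" and S: "S \<subseteq> A" and u: "is_lub_in A S u"
  shows "p u = Sup (p ` S)"
proof (rule order.antisym)
  have emb: "\<And>a b. a \<in> A \<Longrightarrow> b \<in> A \<Longrightarrow> a \<le> b \<longleftrightarrow> p a \<le> p b"
    using p by (simp add: dm_completion_UNIV)
  show "Sup (p ` S) \<le> p u"
    using u S emb by (auto simp: is_lub_in_def intro!: Sup_least)
  have "\<exists>T\<subseteq>A. Sup (p ` S) = Inf (p ` T)"
    using p unfolding dm_completion_UNIV by (elim conjE) (erule spec)
  then obtain T where T: "T \<subseteq> A" "Sup (p ` S) = Inf (p ` T)" by blast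
  have "p u \<le> p t" if t: "t \<in> T" for t
  proof -
    have "p s \<le> p t" if "s \<in> S" for s
    proof -
      have "p s \<le> Sup (p ` S)" using that by (simp add: Sup_upper)
      also have "\<dots> \<le> p t" unfolding T(2) using t by (simp add: Inf_lower)
      finally show ?thesis .
    qed
    then have "\<forall>s\<in>S. s \<le> t" using emb S T(1) t by blast
    then have "u \<le> t" using u T(1) t by (auto simp: is_lub_in_def)
    then show ?thesis using emb u T(1) t by (auto simp: is_lub_in_def)
  qed
  then show "p u \<le> Sup (p ` S)" unfolding T(2) by (auto intro!: Inf_greatest)
qed

text \<open>The dual argument, with join-generation in place of meet-generation.\<close>

lemma dm_completion_preserves_glb:
  fixes p :: "'a::order \<Rightarrow> 'b::complete_lattice"
  assumes p: "dm_completion A UNIV p" and S: "S \<subseteq> A" and l: "is_glb_in A S l"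
  shows "p l = Inf (p ` S)"
proof (rule order.antisym)
  have emb: "\<And>a b. a \<in> A \<Longrightarrow> b \<in> A \<Longrightarrow> a \<le> b \<longleftrightarrow> p a \<le> p b"
    using p by (simp add: dm_completion_UNIV)
  show "p l \<le> Inf (p ` S)"
    using l S emb by (auto simp: is_glb_in_def intro!: Inf_greatest)
  have "\<exists>T\<subseteq>A. Inf (p ` S) = Sup (p ` T)"
    using p unfolding dm_completion_UNIV by (elim conjE) (erule spec)
  then obtain T where T: "T \<subseteq> A" "Inf (p ` S) = Sup (p ` T)" by blast
  have "p t \<le> p l" if t: "t \<in> T" for t
  proof -
    have "p t \<le> p s" if "s \<in> S" for s
    proof -
      have "p t \<le> Inf (p ` S)" unfolding T(2) using t by (simp add: Sup_upper)
      also have "\<dots> \<le> p s" using that by (simp add: Inf_lower)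
      finally show ?thesis .
    qed
    then have "\<forall>s\<in>S. t \<le> s" using emb S T(1) t by blast
    then have "t \<le> l" using l T(1) t by (auto simp: is_glb_in_def)
    then show ?thesis using emb l T(1) t by (auto simp: is_glb_in_def)
  qed
  then show "Inf (p ` S) \<le> p l" unfolding T(2) by (auto intro!: Sup_least)
qed

section \<open>Perfect regularity in terms of completions\<close>

lemma dm_completion_Coz_mem_Coz:
  fixes p :: "'a::frame \<Rightarrow> 'b::frame"
  assumes p: "dm_completion Coz UNIV p" and a: "a \<in> Coz"
  shows "p a \<in> Coz"
proof -
  obtain h :: "real set \<Rightarrow> 'a" where h: "opens_frame_hom h" "h (UNIV - {0}) = a"
    using a by (rule CozE)
  \<comment> \<open>Since \<open>h\<close> takes cozero values on open sets, the joins and finite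
    meets that it produces in the frame are also joins and meets in \<open>Coz\<close>, which
    \<open>p\<close> preserves.\<close>
  note C = hom_open_mem_Coz[OF h(1)]
  have "opens_frame_hom (\<lambda>U. p (h U))"
    unfolding opens_frame_hom_def
  proof (intro conjI allI impI)
    \<comment> \<open>The top element is treated as the meet of the empty family.\<close>
    have "is_glb_in Coz {} (h UNIV)"
      using C[OF open_UNIV] opens_frame_hom_UNIV[OF h(1)] by (simp add: is_glb_in_def)
    then show "p (h UNIV) = top" using dm_completion_preserves_glb[OF p] by fastforce
  next
    fix U V :: "real set" assume o: "open U" "open V"
    have "is_glb_in Coz {h U, h V} (h (U \<inter> V))"
      using C[OF open_Int[OF o]] opens_frame_hom_Int[OF h(1) o] by (simp add: is_glb_in_def)
    then have "p (h (U \<inter> V)) = Inf (p ` {h U, h V})"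
      using C o by (intro dm_completion_preserves_glb[OF p]) auto
    then show "p (h (U \<inter> V)) = inf (p (h U)) (p (h V))" by simp
  next
    fix \<U> :: "real set set" assume \<U>: "\<forall>U\<in>\<U>. open U"
    have "is_lub_in Coz (h ` \<U>) (h (\<Union>\<U>))"
      using C[of "\<Union>\<U>"] \<U> opens_frame_hom_Union[OF h(1), of \<U>]
      by (auto simp: is_lub_in_def intro!: Sup_upper Sup_least)
    then have "p (h (\<Union>\<U>)) = Sup (p ` h ` \<U>)"
      using C \<U> by (intro dm_completion_preserves_lub[OF p]) auto
    then show "p (h (\<Union>\<U>)) = Sup ((\<lambda>U. p (h U)) ` \<U>)" by (simp add: image_image)
  qed
  then show ?thesis using h(2) unfolding Coz_def by blast
qed

text \<open>Forwards the embedding is the identity. Backwards an arbitrary \<open>p\<close>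
  suffices: its image consists of cozero elements and generates by joins and by meets.\<close>

lemma perfectly_regular_iff_dm_completion:
  "perfectly_regular TYPE('a::frame) \<longleftrightarrow> (\<exists>p :: 'a \<Rightarrow> 'a. dm_completion Coz UNIV p)"
proof
  assume "perfectly_regular TYPE('a)"
  then have "dm_completion Coz UNIV (id :: 'a \<Rightarrow> 'a)"
    by (auto simp: dm_completion_UNIV perfectly_regular_def join_generates_def meet_generates_def)
  then show "\<exists>p :: 'a \<Rightarrow> 'a. dm_completion Coz UNIV p" by blast
next
  assume "\<exists>p :: 'a \<Rightarrow> 'a. dm_completion Coz UNIV p"
  then obtain p :: "'a \<Rightarrow> 'a" where p: "dm_completion Coz UNIV p" by blast
  then have "p ` S \<subseteq> Coz" if "S \<subseteq> Coz" for S
    using that dm_completion_Coz_mem_Coz by blast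
  then show "perfectly_regular TYPE('a)"
    using p unfolding dm_completion_UNIV perfectly_regular_def join_generates_def meet_generates_def
    by metis
qed

theorem theorem2p7:
  shows "(perfectly_regular TYPE('a::frame) \<longleftrightarrow> (UNIV :: 'a set) \<cong> DM (Coz :: 'a set)) \<and>
         (perfectly_regular TYPE('a) \<longleftrightarrow> (UNIV :: 'a set) \<cong> BL (Coz :: 'a set))"
proof -
  \<comment> \<open>Left to right is uniqueness of the completion; right to left transports the
    principal-ideal embedding into \<open>DM Coz\<close> along the inverse isomorphism.\<close>
  have "(\<exists>p :: 'a \<Rightarrow> 'a. dm_completion Coz UNIV p) \<longleftrightarrow> (UNIV :: 'a set) \<cong> DM (Coz :: 'a set)"
    using dm_completion_unique dm_completion_order_isomorphic[OF dm_completion_DM]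
      order_isomorphic_sym by blast
  then show ?thesis by (simp add: perfectly_regular_iff_dm_completion BL_Coz)
qed

end
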